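(* Let $q$ be a prime power, $n$ a positive integer, and $t$ a nontrivial divisor of $n$ (that is, $t\mid n$ and $1<t<n$). Let $f\in\mathcal{L}_{n,q}$. (i) If $f$ is R-$q^t$-partially scattered, then $w_{L_f}(P)\le n/2$ for every point $P\in\mathrm{PG}(1,q^n)$. (ii) If $f$ is L-$q^t$-partially scattered, then $w_{L_f}(P)\le t$ for every point $P\in\mathrm{PG}(1,q^n)$.
   Context: $\mathcal{L}_{n,q}$ is the set of $q$-polynomials $\sum_{i=0}^{n-1}a_ix^{q^i}$ with $a_i\in\mathbb{F}_{q^n}$, identified with the $\mathbb{F}_q$-linear endomorphisms of $\mathbb{F}_{q^n}$. The graph of $f$ is the $\mathbb{F}_q$-subspace $\mathcal{G}_f=\{(y,f(y)) : y\in\mathbb{F}_{q^n}\}$ of $\mathbb{F}_{q^n}^2$, and $L_f=\{\langle(y,f(y))\rangle_{\mathbb{F}_{q^n}} : y\in\mathbb{F}_{q^n}^*\}\subseteq\mathrm{PG}(1,q^n)$. The weight of a point $P=\langle v\rangle_{\mathbb{F}_{q^n}}$ ($0\ne v\in\mathbb{F}_{q^n}^2$) in $L_f$ is $w_{L_f}(P)=\dim_{\mathbb{F}_q}(\mathcal{G}_f\cap\langle v\rangle_{\mathbb{F}_{q^n}})$. The polynomial $f$ is L-$q^t$-partially scattered if for all $y,z\in\mathbb{F}_{q^n}^*$, $\frac{f(y)}{y}=\frac{f(z)}{z}$ implies $\frac{y}{z}\in\mathbb{F}_{q^t}$. It is R-$q^t$-partially scattered if for all $y,z\in\mathbb{F}_{q^n}^*$,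 $\frac{f(y)}{y}=\frac{f(z)}{z}$ and $\frac{y}{z}\in\mathbb{F}_{q^t}$ imply $\frac{y}{z}\in\mathbb{F}_q$. *)

theory Defs
  imports
    "HOL-Library.Cardinality"
    "HOL-Computational_Algebra.Polynomial"
    "HOL-Number_Theory.Prime_Powers"
    "HOL-Number_Theory.Residues"
    "HOL-Algebra.Subrings"
    "Jordan_Normal_Form.VS_Connect"
begin

text \<open>
  The field with \<open>q ^ n\<close> elements is a type \<open>'a :: finite_field\<close> with \<open>CARD('a) = q ^ n\<close>.
  For \<open>m = q ^ t\<close> with \<open>t dvd n\<close>, its unique subfield with \<open>m\<close> elements is the set of
  fixed points of \<open>x \<mapsto> x ^ m\<close>; see \<open>subfield_iff_eq_subGF\<close> below.
\<close>

definition subGF :: "nat \<Rightarrow> 'a::field set" where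
  "subGF m = {x. x ^ m = x}"

definition q_polynomials :: "nat \<Rightarrow> nat \<Rightarrow> 'a::field poly set" where
  "q_polynomials q n = {\<Sum>i<n. monom (a i) (q ^ i) | a. True}"

definition graph_of :: "'a::field poly \<Rightarrow> ('a \<times> 'a) set" where
  "graph_of f = {(y, poly f y) | y. True}"

definition line_through :: "'a::field \<times> 'a \<Rightarrow> ('a \<times> 'a) set" where
  "line_through v = {(c * fst v, c * snd v) | c. True}"

definition PG1 :: "('a::field \<times> 'a) set set" where
  "PG1 = {line_through v | v. v \<noteq> (0, 0)}"

text \<open>The ring multiplication and unit are not part of a module and stay unspecified.\<close>

definition plane :: "('a::field, 'a \<times> 'a) module" where
  "plane = \<lparr>carrier = UNIV, mult = undefined, one = undefined, zero = (0, 0),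
     add = (\<lambda>u v. (fst u + fst v, snd u + snd v)),
     smult = (\<lambda>c v. (c * fst v, c * snd v))\<rparr>"

text \<open>
  The constant \<open>vectorspace.dim\<close> is meaningful only on vector spaces;
  \<open>vectorspace_graph_inter_point\<close> below shows that it is applied to one.
\<close>

definition weight :: "nat \<Rightarrow> 'a::field poly \<Rightarrow> ('a \<times> 'a) set \<Rightarrow> nat" where
  "weight q f P =
     vectorspace.dim (class_ring\<lparr>carrier := subGF q\<rparr>) (plane\<lparr>carrier := graph_of f \<inter> P\<rparr>)"

definition L_partially_scattered :: "nat \<Rightarrow> nat \<Rightarrow> 'a::field poly \<Rightarrow> bool" where
  "L_partially_scattered q t f \<longleftrightarrow>
     (\<forall>y z. y \<noteq> 0 \<longrightarrow> z \<noteq> 0 \<longrightarrow> poly f y / y = poly f z / z \<longrightarrow> y / z \<in> subGF (q ^ t))"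

definition R_partially_scattered :: "nat \<Rightarrow> nat \<Rightarrow> 'a::field poly \<Rightarrow> bool" where
  "R_partially_scattered q t f \<longleftrightarrow>
     (\<forall>y z. y \<noteq> 0 \<longrightarrow> z \<noteq> 0 \<longrightarrow> poly f y / y = poly f z / z \<longrightarrow> y / z \<in> subGF (q ^ t) \<longrightarrow>
        y / z \<in> subGF q)"


lemma frobenius_add:
  fixes x y :: "'a::finite_field"
  assumes "primepow q" "CARD('a) = q ^ n"
  shows "(x + y) ^ (q ^ t) = x ^ (q ^ t) + y ^ (q ^ t)"
proof -
  from assms(1) obtain p k where pk: "prime p" "q = p ^ k"
    by (auto simp: primepow_def)
  have c: "prime CHAR('a)"
    by (simp add: finite_imp_CHAR_pos prime_CHAR_semidom)
  have "CHAR('a) dvd p ^ (k * n)"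
    using CHAR_dvd_CARD[where ?'a = 'a] assms(2) pk(2) by (simp add: power_mult)
  then have "CHAR('a) = p"
    using c pk(1) prime_dvd_power primes_dvd_imp_eq by blast
  then show ?thesis
    using c pk by (intro freshmans_dream'[of _ "k * t"]) (auto simp: power_mult)
qed

lemma frobenius_minus:
  fixes x :: "'a::finite_field"
  assumes "primepow q" "CARD('a) = q ^ n"
  shows "(- x) ^ (q ^ t) = - (x ^ (q ^ t))"
proof -
  have "q > 0"
    using assms(1) primepow_gt_Suc_0[of q] by simp
  then have "x ^ (q ^ t) + (- x) ^ (q ^ t) = 0"
    using frobenius_add[OF assms, of x "- x" t] by (simp add: power_0_left)
  then show ?thesis
    by (simp add: eq_neg_iff_add_eq_0 add.commute)
qed

lemma subfield_subGF:
  assumes "primepow q" "CARD('a::finite_field) = q ^ n"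
  shows "subfield (subGF (q ^ t) :: 'a set) class_ring"
proof (rule field.subfieldI'[OF class_field])
  show "subring (subGF (q ^ t) :: 'a set) class_ring"
    by (rule ring.subringI[OF class_ring.ring_axioms])
      (auto simp: class_ring_simps subGF_def power_mult_distrib frobenius_add[OF assms]
         frobenius_minus[OF assms])
next
  fix k :: 'a
  assume k: "k \<in> subGF (q ^ t) - {\<zero>\<^bsub>class_ring\<^esub>}"
  have "inv\<^bsub>class_ring\<^esub> k = inverse k"
    using k by (intro comm_monoid.comm_inv_char[OF class_cring.comm_monoid_axioms]) auto
  then show "inv\<^bsub>class_ring\<^esub> k \<in> subGF (q ^ t)"
    using k by (simp add: subGF_def power_inverse)
qed

lemma card_subGF:
  assumes "primepow q" "CARD('a::finite_field) = q ^ n" "t dvd n" "t > 0"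
  shows "card (subGF (q ^ t) :: 'a set) = q ^ t"
proof -
  define Q where "Q = q ^ t"
  have q1: "q > 1"
    using assms(1) primepow_gt_Suc_0 by auto
  then have Q1: "Q > 1"
    unfolding Q_def using assms(4) by (metis one_less_power)
  obtain s where s: "n = t * s"
    using assms(3) by auto
  have N: "CARD('a) = Q ^ s"
    using assms(2) by (simp add: s Q_def power_mult)
  have "int Q - 1 dvd int Q ^ s - 1"
    using power_diff_1_eq[of "int Q" s] by simp
  then have "int (Q - 1) dvd int (Q ^ s - 1)"
    using Q1 by (simp add: of_nat_diff)
  then obtain m where m: "CARD('a) - 1 = (Q - 1) * m"
    using N by (auto simp: int_dvd_int_iff)
  have "card {0, 1 :: 'a} \<le> CARD('a)"
    by (intro card_mono) auto
  then have N2: "CARD('a) > 1"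
    by simp
  then have m0: "m > 0"
    using m by (cases m) auto
  define A where "A = {x :: 'a. x ^ (Q - 1) = 1}"
  define g where "g = (\<Sum>i<m. monom (1 :: 'a) ((Q - 1) * i))"
  define B where "B = {x. poly g x = 0}"
  have A_roots: "A = {x. poly (monom 1 (Q - 1) - 1) x = 0}"
    by (simp add: A_def poly_monom)
  have "coeff (monom (1 :: 'a) (Q - 1) - 1) (Q - 1) = 1"
    using Q1 by simp
  then have "monom (1 :: 'a) (Q - 1) - 1 \<noteq> 0"
    by (metis coeff_0 zero_neq_one)
  then have "card A \<le> degree (monom (1 :: 'a) (Q - 1) - 1)"
    unfolding A_roots by (rule card_poly_roots_bound)
  also have "\<dots> \<le> Q - 1"
    by (intro degree_diff_le) (auto simp: degree_monom_le)
  finally have A_le: "card A \<le> Q - 1" .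
  have "coeff g 0 = (\<Sum>i<m. if i = 0 then 1 else 0)"
    unfolding g_def coeff_sum using Q1 by (intro sum.cong) auto
  then have "coeff g 0 = 1"
    using m0 by simp
  then have "g \<noteq> 0"
    by auto
  then have "card B \<le> degree g"
    unfolding B_def by (rule card_poly_roots_bound)
  also have "\<dots> \<le> (Q - 1) * (m - 1)"
    unfolding g_def
    by (intro degree_sum_le) (auto intro!: order.trans[OF degree_monom_le])
  finally have B_le: "card B \<le> (Q - 1) * (m - 1)" .
  have "x \<in> A \<union> B" if "x \<noteq> 0" for x :: 'a
  proof -
    have "x * x ^ (CARD('a) - 1) = x"
      using finite_field_power_card_eq_same[of x] N2 by (simp flip: power_Suc)
    then have "(x ^ (Q - 1)) ^ m = 1"
      using that m by (metis mult_cancel_left2 power_mult)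
    then have "(x ^ (Q - 1) - 1) * (\<Sum>i<m. (x ^ (Q - 1)) ^ i) = 0"
      using power_diff_1_eq[of "x ^ (Q - 1)" m] by simp
    then show ?thesis
      by (auto simp: A_def B_def g_def poly_sum poly_monom power_mult)
  qed
  then have "card (UNIV - {0 :: 'a}) \<le> card (A \<union> B)"
    by (intro card_mono) auto
  also have "\<dots> \<le> card A + card B"
    by (rule card_Un_le)
  finally have "CARD('a) - 1 \<le> card A + card B"
    by (simp add: card_Diff_singleton)
  moreover have "(Q - 1) * m = (Q - 1) + (Q - 1) * (m - 1)"
    using m0 by (cases m) auto
  ultimately have cA: "card A = Q - 1"
    using A_le B_le m by linarith
  have "x ^ Q = x * x ^ (Q - 1)" for x :: 'a
    using Q1 by (simp flip: power_Suc)
  then have "subGF Q = insert 0 A"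
    using Q1 by (auto simp: subGF_def A_def)
  moreover have "0 \<notin> A"
    using Q1 by (simp add: A_def power_0_left)
  ultimately have "card (subGF Q :: 'a set) = Q"
    using cA Q1 by (simp add: card_insert_if)
  then show ?thesis
    by (simp add: Q_def)
qed

lemma subfield_iff_eq_subGF:
  assumes "primepow q" "CARD('a::finite_field) = q ^ n" "t dvd n" "t > 0"
  shows "subfield K class_ring \<and> card K = q ^ t \<longleftrightarrow> K = (subGF (q ^ t) :: 'a set)"
proof
  assume K: "subfield K class_ring \<and> card K = q ^ t"
  have fin: "finite K" by simp
  note ring = subringE[OF subfieldE(1)[OF conjunct1[OF K]], unfolded class_ring_simps]
  have z: "0 \<in> K"
    using ring(2) by simp
  then have pos: "card K > 0"
    using fin card_gt_0_iff by blast
  have "x ^ card K = x" if x: "x \<in> K" for x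
  proof (cases "x = 0")
    case False
    have "(*) x ` (K - {0}) = K - {0}"
      using x False ring(6)
      by (intro card_subset_eq) (auto simp: card_image inj_on_def)
    then have "\<Prod>(K - {0}) = (\<Prod>y\<in>K - {0}. x * y)"
      using prod.reindex[of "(*) x" "K - {0}" "\<lambda>y. y"] False by (simp add: inj_on_def)
    also have "\<dots> = x ^ (card K - 1) * \<Prod>(K - {0})"
      using z fin by (simp add: prod.distrib card_Diff_singleton)
    finally have "x ^ (card K - 1) = 1"
      using fin by (simp add: prod_zero_iff)
    then have "x * x ^ (card K - 1) = x"
      by simp
    then show ?thesis
      using pos by (simp flip: power_Suc)
  qed (use pos in auto)
  then have "K \<subseteq> subGF (q ^ t)"
    using K by (auto simp: subGF_def)
  then show "K = subGF (q ^ t)"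
    using K card_subGF[OF assms] by (intro card_subset_eq) auto
qed (use subfield_subGF[OF assms(1,2)] card_subGF[OF assms] in auto)

lemma vectorspace_graph_inter_point:
  fixes f :: "'a::finite_field poly"
  assumes "primepow q" "CARD('a) = q ^ n" "f \<in> q_polynomials q n" "P \<in> PG1"
  shows "vectorspace (class_ring\<lparr>carrier := subGF q\<rparr>) (plane\<lparr>carrier := graph_of f \<inter> P\<rparr>)"
proof -
  let ?K = "class_ring\<lparr>carrier := subGF q\<rparr> :: 'a ring"
  let ?V = "plane\<lparr>carrier := graph_of f \<inter> P\<rparr>"
  have fld: "field ?K"
    using ring.subfield_iff(2)[OF class_ring.ring_axioms subfield_subGF[OF assms(1,2), of 1]] by simp
  obtain a where f: "f = (\<Sum>i<n. monom (a i) (q ^ i))"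
    using assms(3) by (auto simp: q_polynomials_def)
  have pf: "poly f x = (\<Sum>i<n. a i * x ^ (q ^ i))" for x
    by (simp add: f poly_sum poly_monom)
  have add: "poly f (x + y) = poly f x + poly f y" for x y
    by (simp add: pf frobenius_add[OF assms(1,2)] distrib_left sum.distrib)
  have "c ^ (q ^ i) = c" if "c \<in> subGF q" for c :: 'a and i
    using that by (induction i) (auto simp: subGF_def power_mult)
  then have smult: "poly f (c * x) = c * poly f x" if "c \<in> subGF q" for c x
    using that by (simp add: pf power_mult_distrib sum_distrib_left mult.left_commute)
  have minus: "poly f (- x) = - poly f x" for x
    using frobenius_minus[OF assms(1,2)] by (simp add: pf sum_negf)
  have zero: "poly f 0 = 0"
    using add[of 0 0] by (metis add_0 add_cancel_left_left)
  obtain v where P: "P = line_through v"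
    using assms(4) by (auto simp: PG1_def)
  have P0: "(0, 0) \<in> P"
    by (auto simp: P line_through_def intro: exI[of _ 0])
  have Padd: "(x + x', y + y') \<in> P" if "(x, y) \<in> P" "(x', y') \<in> P" for x y x' y'
    using that by (auto simp: P line_through_def simp flip: distrib_right)
  have Psmult: "(c * x, c * y) \<in> P" if "(x, y) \<in> P" for c x y
    using that by (auto simp: P line_through_def simp flip: mult.assoc)
  have Pminus: "(- x, - y) \<in> P" if "(x, y) \<in> P" for x y
    using Psmult[OF that, of "- 1"] by simp
  have "abelian_group ?V"
  proof (rule abelian_groupI)
    fix u assume "u \<in> carrier ?V"
    then show "\<exists>w\<in>carrier ?V. w \<oplus>\<^bsub>?V\<^esub> u = \<zero>\<^bsub>?V\<^esub>"
      by (intro bexI[of _ "(- fst u, - snd u)"])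
        (auto simp: plane_def graph_of_def minus intro: Pminus)
  qed (auto simp: plane_def graph_of_def add zero algebra_simps intro: P0 Padd)
  then have "module ?K ?V"
    using fld
    by (intro moduleI)
      (auto simp: field.axioms domain.axioms plane_def graph_of_def smult algebra_simps
         intro: Psmult fieldE)
  then show ?thesis
    using fld by (simp add: vectorspace_def)
qed

end

theory Submission
  imports Defs
begin

text \<open>
  The nonzero vectors \<open>(y, f y)\<close> on a point \<open>P\<close> share the quotient \<open>f y / y\<close>, so the scattering
  conditions restrict the quotients of nonzero elements of the additive group \<open>W\<close> of first
  coordinates of \<open>G\<^sub>f \<inter> P\<close>, which has \<open>q ^ w\<close> elements for \<open>w\<close> the weight of \<open>P\<close>.
  If \<open>f\<close> is L-scattered, then \<open>W\<close> is contained in a multiple of \<open>GF(q ^ t)\<close>, hence \<open>w \<le> t\<close>.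
  If \<open>2 w > n\<close>, then \<open>W\<close> meets each of its nonzero multiples nontrivially, so every nonzero
  element of the field is a quotient of elements of \<open>W\<close>. This contradicts R-scatteredness,
  because \<open>GF(q ^ t)\<close> is larger than \<open>GF(q)\<close>.
\<close>

lemma (in vectorspace) bij_betw_lincomb:
  assumes "finite B" "basis B"
  shows "bij_betw (\<lambda>a. lincomb a B) (B \<rightarrow>\<^sub>E carrier K) (carrier V)"
proof -
  have B_carrier: "B \<subseteq> carrier V"
    using assms(2) by (simp add: basis_def)
  have unique: "\<exists>!a. a \<in> B \<rightarrow>\<^sub>E carrier K \<and> lincomb a B = v" if "v \<in> carrier V" for v
    using basis_criterion[OF assms(1) B_carrier] assms(2) that by blast
  have closed: "lincomb a B \<in> carrier V" if "a \<in> B \<rightarrow>\<^sub>E carrier K" for a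
    using that B_carrier by (intro lincomb_closed) auto
  show ?thesis
  proof (rule bij_betw_imageI)
    show "inj_on (\<lambda>a. lincomb a B) (B \<rightarrow>\<^sub>E carrier K)"
      using unique closed by (intro inj_onI) blast
    show "(\<lambda>a. lincomb a B) ` (B \<rightarrow>\<^sub>E carrier K) = carrier V"
      using unique closed by blast
  qed
qed

lemma (in vectorspace) card_carrier_eq_power_dim:
  assumes fin_dim
  shows "card (carrier V) = card (carrier K) ^ dim"
proof -
  obtain B where B: "finite B" "basis B"
    using finite_basis_exists[OF assms] by blast
  have "card (carrier V) = card (B \<rightarrow>\<^sub>E carrier K)"
    using bij_betw_same_card[OF bij_betw_lincomb[OF B]] by simp
  also have "\<dots> = card (carrier K) ^ dim"
    using B by (simp add: card_PiE dim_basis)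
  finally show ?thesis .
qed

lemma (in vectorspace) fin_dim_if_finite_carrier:
  assumes "finite (carrier V)"
  shows fin_dim
proof -
  have "gen_set (carrier V)"
    using in_own_span[of "carrier V"] span_is_subset2[of "carrier V"] by auto
  then show ?thesis
    using assms by (auto simp: fin_dim_def)
qed

lemma ex_nonzero_inter_if_card_less:
  fixes A B :: "'a::{group_add, finite} set"
  assumes diff_A: "\<And>x y. x \<in> A \<Longrightarrow> y \<in> A \<Longrightarrow> x - y \<in> A"
    and diff_B: "\<And>x y. x \<in> B \<Longrightarrow> y \<in> B \<Longrightarrow> x - y \<in> B"
    and card: "CARD('a) < card A * card B"
  shows "\<exists>x\<in>A \<inter> B. x \<noteq> 0"
proof -
  have "\<not> inj_on (\<lambda>(a, b). - a + b) (A \<times> B)"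
    using card card_inj_on_le[of "\<lambda>(a, b). - a + b" "A \<times> B" UNIV]
    by (auto simp: card_cartesian_product)
  then obtain a b a' b' where
    mem: "a \<in> A" "b \<in> B" "a' \<in> A" "b' \<in> B" and
    neq: "(a, b) \<noteq> (a', b')" and collision: "- a + b = - a' + b'"
    by (auto simp: inj_on_def)
  have "a' + (- a + b) = b'"
    by (simp add: collision flip: add.assoc)
  then have same_difference: "a' - a = b' - b"
    by (metis add.assoc add_diff_cancel diff_conv_add_uminus)
  show ?thesis
  proof (rule bexI)
    show "a' - a \<noteq> 0"
      using neq same_difference by auto
    show "a' - a \<in> A \<inter> B"
      using diff_A[of a' a] diff_B[of b' b] mem same_difference by simp
  qed
qed

definition quotients :: "'a::division_ring set \<Rightarrow> 'a set" where
  "quotients W = {y / z | y z. y \<in> W - {0} \<and> z \<in> W - {0}}"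

lemma card_le_if_quotients_subset:
  assumes "finite K" "0 \<in> K" "quotients W \<subseteq> K"
  shows "card W \<le> card K"
proof -
  consider (trivial) "W \<subseteq> {0}" | (nontrivial) z where "z \<in> W - {0}"
    by blast
  then show ?thesis
  proof cases
    case trivial
    then show ?thesis
      using assms(1,2) by (intro card_mono) auto
  next
    case nontrivial
    have "W \<subseteq> (\<lambda>k. k * z) ` K"
    proof
      fix y
      assume "y \<in> W"
      then have "y / z \<in> K"
        using nontrivial assms(2,3) by (cases "y = 0") (auto simp: quotients_def)
      moreover have "y = y / z * z"
        using nontrivial by (simp add: divide_inverse mult.assoc)
      ultimately show "y \<in> (\<lambda>k. k * z) ` K"
        by (rule rev_image_eqI)
    qed
    then show ?thesis
      using assms(1) by (intro surj_card_le)
  qed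
qed

lemma nonzero_in_quotients_if_card_square_greater:
  fixes W :: "'a::{division_ring, finite} set"
  assumes diff_W: "\<And>x y. x \<in> W \<Longrightarrow> y \<in> W \<Longrightarrow> x - y \<in> W"
    and card: "CARD('a) < card W * card W"
    and "c \<noteq> 0"
  shows "c \<in> quotients W"
proof -
  have "card ((*) c ` W) = card W"
    using \<open>c \<noteq> 0\<close> by (intro card_image) (simp add: inj_on_def)
  moreover have "x - y \<in> (*) c ` W" if "x \<in> (*) c ` W" "y \<in> (*) c ` W" for x y
    using that diff_W by (auto simp flip: right_diff_distrib)
  ultimately obtain z where "z \<in> W" "c * z \<in> W" "c * z \<noteq> 0"
    using ex_nonzero_inter_if_card_less[of W "(*) c ` W"] diff_W card by auto
  moreover from this have "c = (c * z) / z"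
    by (simp add: nonzero_eq_divide_eq)
  ultimately show ?thesis
    unfolding quotients_def by force
qed

lemma zero_in_subGF: "m > 0 \<Longrightarrow> 0 \<in> subGF m"
  by (simp add: subGF_def)

definition first_coords :: "'a::field poly \<Rightarrow> ('a \<times> 'a) set \<Rightarrow> 'a set" where
  "first_coords f P = {y. (y, poly f y) \<in> P}"

lemma graph_inter_eq_image_first_coords:
  "graph_of f \<inter> P = (\<lambda>y. (y, poly f y)) ` first_coords f P"
  by (auto simp: graph_of_def first_coords_def)

lemma first_coords_quotient_eq:
  assumes "P \<in> PG1" "y \<in> first_coords f P - {0}" "z \<in> first_coords f P - {0}"
  shows "poly f y / y = poly f z / z"
  using assms by (auto simp: PG1_def line_through_def first_coords_def)

lemma quotients_first_coords_if_L_partially_scattered: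
  assumes "L_partially_scattered q t f" "P \<in> PG1"
  shows "quotients (first_coords f P) \<subseteq> subGF (q ^ t)"
  using assms first_coords_quotient_eq
  unfolding quotients_def L_partially_scattered_def by blast

lemma quotients_first_coords_if_R_partially_scattered:
  assumes "R_partially_scattered q t f" "P \<in> PG1"
  shows "quotients (first_coords f P) \<inter> subGF (q ^ t) \<subseteq> subGF q"
  using assms first_coords_quotient_eq
  unfolding quotients_def R_partially_scattered_def by blast

locale q_polynomial_at_point =
  fixes q n :: nat and f :: "'a::finite_field poly" and P :: "('a \<times> 'a) set"
  assumes primepow: "primepow q"
    and card_field: "CARD('a) = q ^ n"
    and q_polynomial: "f \<in> q_polynomials q n"
    and point: "P \<in> PG1"
begin

lemma q_greater_1: "q > 1"
  using primepow_gt_Suc_0[OF primepow] by simp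

lemma card_subGF_base: "card (subGF q :: 'a set) = q"
  using card_subGF[OF primepow card_field, of 1] by simp

lemma card_first_coords: "card (first_coords f P) = q ^ weight q f P"
proof -
  interpret vectorspace "class_ring\<lparr>carrier := subGF q\<rparr>" "plane\<lparr>carrier := graph_of f \<inter> P\<rparr>"
    using primepow card_field q_polynomial point by (rule vectorspace_graph_inter_point)
  have "card (first_coords f P) = card (graph_of f \<inter> P)"
    by (simp add: graph_inter_eq_image_first_coords card_image inj_on_def)
  also have "\<dots> = q ^ weight q f P"
    using card_carrier_eq_power_dim[OF fin_dim_if_finite_carrier]
    by (simp add: weight_def card_subGF_base)
  finally show ?thesis .
qed

lemma diff_in_first_coords:
  assumes "y \<in> first_coords f P" "z \<in> first_coords f P"
  shows "y - z \<in> first_coords f P"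
proof -
  let ?V = "plane\<lparr>carrier := graph_of f \<inter> P\<rparr>"
  let ?u = "(y, poly f y)" and ?v = "(z, poly f z)"
  interpret vectorspace "class_ring\<lparr>carrier := subGF q\<rparr>" ?V
    using primepow card_field q_polynomial point by (rule vectorspace_graph_inter_point)
  have "(- 1 :: 'a) \<in> subGF q"
    using frobenius_minus[OF primepow card_field, of 1 1] by (simp add: subGF_def)
  then have "?u \<oplus>\<^bsub>?V\<^esub> (- 1 \<odot>\<^bsub>?V\<^esub> ?v) \<in> carrier ?V"
    using assms
    by (intro M.a_closed smult_closed) (auto simp: graph_inter_eq_image_first_coords)
  then show ?thesis
    by (auto simp: plane_def graph_inter_eq_image_first_coords)
qed

lemma weight_le_if_L_partially_scattered:
  assumes "t dvd n" "t > 0" and "L_partially_scattered q t f"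
  shows "weight q f P \<le> t"
proof -
  have "quotients (first_coords f P) \<subseteq> subGF (q ^ t)"
    using assms(3) point by (rule quotients_first_coords_if_L_partially_scattered)
  then have "card (first_coords f P) \<le> card (subGF (q ^ t) :: 'a set)"
    using q_greater_1 by (intro card_le_if_quotients_subset zero_in_subGF) auto
  then have "q ^ weight q f P \<le> q ^ t"
    by (simp add: card_first_coords card_subGF[OF primepow card_field assms(1,2)])
  then show ?thesis
    using q_greater_1 by simp
qed

lemma weight_le_half_if_R_partially_scattered:
  assumes "t dvd n" "t > 1" and R: "R_partially_scattered q t f"
  shows "2 * weight q f P \<le> n"
proof (rule ccontr)
  assume "\<not> 2 * weight q f P \<le> n"
  then have "CARD('a) < card (first_coords f P) * card (first_coords f P)"
    using q_greater_1 by (simp add: card_field card_first_coords flip: power_add)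
  then have all_quotients: "c \<in> quotients (first_coords f P)" if "c \<noteq> 0" for c
    using diff_in_first_coords that by (intro nonzero_in_quotients_if_card_square_greater)
  have "(subGF (q ^ t) :: 'a set) \<subseteq> subGF q"
  proof
    fix c :: 'a
    assume "c \<in> subGF (q ^ t)"
    then show "c \<in> subGF q"
      using quotients_first_coords_if_R_partially_scattered[OF R point] all_quotients
        zero_in_subGF[of q] q_greater_1 by (cases "c = 0") auto
  qed
  then have "card (subGF (q ^ t) :: 'a set) \<le> card (subGF q :: 'a set)"
    by (intro card_mono) auto
  then have "q ^ t \<le> q ^ 1"
    using card_subGF[OF primepow card_field assms(1)] assms(2) by (simp add: card_subGF_base)
  then show False
    using q_greater_1 assms(2) by (simp only: power_increasing_iff)
qed

end

theorem proposition3p4: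
  fixes q n t :: nat and f :: "'a::finite_field poly"
  assumes "primepow q" and "n > 0" and "CARD('a) = q ^ n"
    and "t dvd n" and "1 < t" and "t < n"
    and "f \<in> q_polynomials q n"
  shows "(R_partially_scattered q t f \<longrightarrow> (\<forall>P\<in>PG1. real (weight q f P) \<le> real n / 2)) \<and>
         (L_partially_scattered q t f \<longrightarrow> (\<forall>P\<in>PG1. weight q f P \<le> t))"
proof (intro conjI impI ballI)
  fix P :: "('a \<times> 'a) set"
  assume "P \<in> PG1"
  then interpret q_polynomial_at_point q n f P
    using assms by unfold_locales
  show "real (weight q f P) \<le> real n / 2" if "R_partially_scattered q t f"
    using weight_le_half_if_R_partially_scattered[OF assms(4,5) that] by linarith
  show "weight q f P \<le> t" if "L_partially_scattered q t f"
    using weight_le_if_L_partially_scattered[OF assms(4) _ that] assms(5) by simp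
qed

end
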